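(* There exists a universal constant $C>0$ such that for any $\alpha\in(0,1)$ and $n\ge C\log(1/\alpha)$, the interval $$\widehat{\mathrm{CI}}=\Big[\max_{1.6\le t\le T}\Big(F_n^{-1}\big(2(1-\Phi(t))\big)+t-\frac{2}{t}\Big),\ \min_{1.6\le t\le T}\Big(F_n^{-1}\big(1-2(1-\Phi(t))\big)-t+\frac{2}{t}\Big)\Big],\qquad T=\Phi^{-1}\Big(1-\sqrt{\tfrac{\log(2/\alpha)}{2n}}\Big),$$ satisfies $$\text{(coverage)}\quad\inf_{\epsilon\in[0,0.05],\,\theta,\,Q}P_{\epsilon,\theta,Q}\big(\theta\in\widehat{\mathrm{CI}}\big)\ge 1-\alpha,$$ $$\text{(length)}\quad\inf_{\epsilon\in[0,0.05],\,\theta,\,Q}P_{\epsilon,\theta,Q}\left(|\widehat{\mathrm{CI}}|\le C'\Big(\frac{1}{\sqrt{\log n}}+\frac{1}{\sqrt{\log(1/\epsilon)}}\Big)\right)\ge 1-\alpha,$$ where $C'>0$ is some constant depending only on $\alpha$.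
   Context: For $\epsilon\in[0,1]$, $\theta\in\mathbb{R}$ and an arbitrary probability distribution $Q$ on $\mathbb{R}$, let $P_{\epsilon,\theta,Q}=(1-\epsilon)N(\theta,1)+\epsilon Q$. The data are $X_1,\ldots,X_n\overset{iid}{\sim}P_{\epsilon,\theta,Q}$, and $P_{\epsilon,\theta,Q}(\cdot)$ of an event about the data is its probability under this sampling. Infima over $\theta,Q$ are over all $\theta\in\mathbb{R}$ and all probability distributions $Q$ on $\mathbb{R}$. $\Phi$ is the standard Gaussian CDF. $F_n(t)=\frac1n\sum_{i=1}^n\mathbf{1}\{X_i\le t\}$ is the empirical CDF, and for any CDF $F$ the quantile function is $F^{-1}(q)=\inf\{t\in\mathbb{R}:F(t)\ge q\}$; thus $F_n^{-1}(q)=X_{(\lceil nq\rceil)}$ in terms of the order statistics $X_{(1)}\le\cdots\le X_{(n)}$. An interval $[L,U]$ is the empty set if $U<L$; $|\cdot|$ is length (Lebesgue measure). The term $1/\sqrt{\log(1/\epsilon)}$ is read as $0$ when $\epsilon=0$.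
   Formalization: For α>1/2 the length bound is claimed only if T≥1.6: otherwise (e.g. n=2, α near 1) max and min range over the empty set and length or coverage fails. Max/min are read as sup/inf (the max need not be attained); over an empty range the interval is the whole line. *)

theory Defs
  imports "HOL-Probability.Probability"
begin

definition contaminated_normal :: "real \<Rightarrow> real \<Rightarrow> real measure \<Rightarrow> real measure" where
  "contaminated_normal \<epsilon> \<theta> Q =
     measure_of UNIV (sets borel)
       (\<lambda>A. ennreal (1 - \<epsilon>) * emeasure (density lborel (normal_density \<theta> 1)) A
            + ennreal \<epsilon> * emeasure Q A)"

definition sampling :: "nat \<Rightarrow> real \<Rightarrow> real \<Rightarrow> real measure \<Rightarrow> (nat \<Rightarrow> real) measure" where
  "sampling n \<epsilon> \<theta> Q = Pi\<^sub>M {..<n} (\<lambda>_. contaminated_normal \<epsilon> \<theta> Q)"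

definition \<Phi> :: "real \<Rightarrow> real" where
  "\<Phi> = cdf std_normal_distribution"

definition ecdf :: "nat \<Rightarrow> (nat \<Rightarrow> real) \<Rightarrow> real \<Rightarrow> real" where
  "ecdf n X t = (\<Sum>i<n. of_bool (X i \<le> t)) / real n"

text \<open>The infimum is real-valued, so this is the quantile of a distribution function \<open>F\<close>
  wherever that quantile is finite, in particular for \<open>0 < q < 1\<close>.\<close>
definition quantile :: "(real \<Rightarrow> real) \<Rightarrow> real \<Rightarrow> real" where
  "quantile F q = Inf {t. F t \<ge> q}"

definition t_max :: "nat \<Rightarrow> real \<Rightarrow> real" where
  "t_max n \<alpha> = quantile \<Phi> (1 - sqrt (ln (2 / \<alpha>) / (2 * real n)))"

text \<open>The lower maximum need not be attained (the quantile function of the sample jumps down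
  as \<open>t\<close> increases), so both endpoints are extrema in the extended reals.  If
  \<open>t_max n \<alpha> < 1.6\<close>, they are extrema over the empty set and the interval is the whole line.\<close>
definition CI_lower :: "nat \<Rightarrow> real \<Rightarrow> (nat \<Rightarrow> real) \<Rightarrow> ereal" where
  "CI_lower n \<alpha> X =
     (SUP t\<in>{1.6..t_max n \<alpha>}. ereal (quantile (ecdf n X) (2 * (1 - \<Phi> t)) + t - 2 / t))"

definition CI_upper :: "nat \<Rightarrow> real \<Rightarrow> (nat \<Rightarrow> real) \<Rightarrow> ereal" where
  "CI_upper n \<alpha> X =
     (INF t\<in>{1.6..t_max n \<alpha>}. ereal (quantile (ecdf n X) (1 - 2 * (1 - \<Phi> t)) - t + 2 / t))"

definition CI :: "nat \<Rightarrow> real \<Rightarrow> (nat \<Rightarrow> real) \<Rightarrow> real set" where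
  "CI n \<alpha> X = {x. CI_lower n \<alpha> X \<le> ereal x \<and> ereal x \<le> CI_upper n \<alpha> X}"

definition inv_sqrt_log_inv :: "real \<Rightarrow> real" where
  "inv_sqrt_log_inv \<epsilon> = (if \<epsilon> = 0 then 0 else 1 / sqrt (ln (1 / \<epsilon>)))"

lemma sets_contaminated_normal [simp, measurable_cong]:
  "sets (contaminated_normal \<epsilon> \<theta> Q) = sets borel"
  unfolding contaminated_normal_def
  by (metis sets.sigma_sets_eq sets_measure_of space_borel subset_Pow_Union UNIV_I
        sets.space_closed)

lemma space_contaminated_normal [simp]: "space (contaminated_normal \<epsilon> \<theta> Q) = UNIV"
  using sets_eq_imp_space_eq[OF sets_contaminated_normal] by simp

lemma emeasure_contaminated_normal:
  assumes "sets Q = sets borel" and A: "A \<in> sets borel"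
  shows "emeasure (contaminated_normal \<epsilon> \<theta> Q) A =
    ennreal (1 - \<epsilon>) * emeasure (density lborel (normal_density \<theta> 1)) A
    + ennreal \<epsilon> * emeasure Q A"
  unfolding contaminated_normal_def
proof (rule emeasure_measure_of_sigma[OF _ _ _ A])
  let ?N = "density lborel (normal_density \<theta> 1)"
  show "sigma_algebra UNIV (sets (borel :: real measure))"
    using sets.sigma_algebra_axioms[of "borel :: real measure"] by simp
  show "positive (sets borel) (\<lambda>A. ennreal (1 - \<epsilon>) * emeasure ?N A + ennreal \<epsilon> * emeasure Q A)"
    by (simp add: positive_def)
  show "countably_additive (sets borel)
      (\<lambda>A. ennreal (1 - \<epsilon>) * emeasure ?N A + ennreal \<epsilon> * emeasure Q A)"
  proof (rule countably_additiveI)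
    fix B :: "nat \<Rightarrow> real set"
    assume B: "range B \<subseteq> sets borel" "disjoint_family B"
    have "(\<Sum>i. emeasure ?N (B i)) = emeasure ?N (\<Union>i. B i)"
      by (rule suminf_emeasure) (use B in auto)
    moreover have "(\<Sum>i. emeasure Q (B i)) = emeasure Q (\<Union>i. B i)"
      by (rule suminf_emeasure) (use B assms in auto)
    ultimately show "(\<Sum>i. ennreal (1 - \<epsilon>) * emeasure ?N (B i) + ennreal \<epsilon> * emeasure Q (B i)) =
        ennreal (1 - \<epsilon>) * emeasure ?N (\<Union>i. B i) + ennreal \<epsilon> * emeasure Q (\<Union>i. B i)"
      by (subst suminf_add[symmetric]) (auto simp: ennreal_suminf_cmult)
  qed
qed

lemma real_distribution_contaminated_normal:
  assumes "real_distribution Q" and "0 \<le> \<epsilon>" "\<epsilon> \<le> 1"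
  shows "real_distribution (contaminated_normal \<epsilon> \<theta> Q)"
proof -
  interpret Q: real_distribution Q by fact
  interpret N: prob_space "density lborel (normal_density \<theta> 1)"
    by (rule prob_space_normal_density) simp
  have "emeasure (contaminated_normal \<epsilon> \<theta> Q) UNIV = ennreal (1 - \<epsilon>) + ennreal \<epsilon>"
    using N.emeasure_space_1 Q.emeasure_space_1 by (simp add: emeasure_contaminated_normal)
  also have "\<dots> = 1"
    using assms by (simp flip: ennreal_plus)
  finally show ?thesis
    by (auto simp: real_distribution_def real_distribution_axioms_def intro!: prob_spaceI)
qed

end

theory Submission
  imports Defs "HOL-Real_Asymp.Real_Asymp"
begin

text \<open>
  Write \<open>\<delta> = sqrt (ln (2 / \<alpha>) / (2 n)) = 1 - \<Phi>(T)\<close>.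

  Coverage: comparing derivatives gives \<open>1 - \<Phi>(t - 2/t) \<ge> 5 (1 - \<Phi>(t))\<close> for \<open>t \<ge> 1.6\<close>, so the
  data fall beyond \<open>\<theta> \<mp> (t - 2/t)\<close> with probability at least \<open>4.75 (1 - \<Phi>(t))\<close>, whereas
  \<open>\<theta> \<in> CI\<close> only needs empirical frequencies above \<open>2 (1 - \<Phi>(t))\<close>.
  This slack makes a uniform (Dvoretzky-Kiefer-Wolfowitz) inequality unnecessary: Hoeffding's
  inequality on the geometric grid \<open>1 - \<Phi>(t\<^sub>k) = \<delta> (3/2)^k\<close> with deviations \<open>\<delta> (3/2)^(k+1)\<close>,
  monotonicity in between, and a union bound with terms \<open>(\<alpha>/2)^(k+2)\<close> suffice.

  Length: it is enough to look at a single \<open>t\<close>.  With \<open>1 - \<Phi>(t) = 2 max \<delta> \<epsilon>\<close>, with probability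
  \<open>1 - \<alpha>\<close> both quantiles lie in \<open>\<theta> \<plusminus> t\<close>, whence the length is at most \<open>4/t\<close>, and the Gaussian
  tail turns \<open>1/t\<close> into the stated rate, because \<open>(1 - \<Phi>(t))^4 \<le> max (1/n) \<epsilon>\<close>.  If \<open>\<epsilon>\<close> is not
  small or \<open>n\<close> is bounded, the rate is bounded below and \<open>t = 1.6\<close> gives a constant bound on the
  length; here \<open>1 - \<Phi>(1.6) > 0.05 \<ge> \<epsilon>\<close> is essential.
\<close>

section \<open>Preliminaries\<close>

lemma le_cINF_triple:
  fixes f :: "'a \<Rightarrow> 'b \<Rightarrow> 'c \<Rightarrow> 'd :: conditionally_complete_lattice"
  assumes "A \<noteq> {}" "B \<noteq> {}" "C \<noteq> {}"
    and "\<And>x y z. x \<in> A \<Longrightarrow> y \<in> B \<Longrightarrow> z \<in> C \<Longrightarrow> a \<le> f x y z"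
  shows "a \<le> (INF (x, y, z) \<in> A \<times> B \<times> C. f x y z)"
  using assms by (intro cINF_greatest) auto

lemma ex_geometric_scale:
  fixes a r x :: real
  assumes "0 < a" "a \<le> x" "1 < r"
  shows "\<exists>k. a * r ^ k \<le> x \<and> x < a * r ^ Suc k"
proof -
  obtain N where "x / a < r ^ N" using real_arch_pow[OF \<open>1 < r\<close>] by blast
  then have "x < a * r ^ N" using \<open>0 < a\<close> by (simp add: field_simps)
  then obtain k where "\<not> x < a * r ^ k" "x < a * r ^ Suc k"
    using ex_least_nat_less[of "\<lambda>k. x < a * r ^ k"] \<open>a \<le> x\<close> by force
  then show ?thesis by (auto simp: not_less)
qed

lemma (in prob_space) prob_ge_if_two_bad_events:
  assumes "A \<in> events" "B \<in> events" "E \<in> events" "space M - (A \<union> B) \<subseteq> E"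
    and "prob A \<le> a / 2" "prob B \<le> a / 2"
  shows "1 - a \<le> prob E"
proof -
  have "prob (A \<union> B) \<le> a"
    using measure_Un_le[OF assms(1,2)] assms(5,6) by linarith
  then have "1 - a \<le> prob (space M - (A \<union> B))" using assms by (simp add: prob_compl)
  also have "\<dots> \<le> prob E" using assms by (intro finite_measure_mono)
  finally show ?thesis .
qed

lemma indep_vars_PiM_component:
  assumes M: "\<And>i. i \<in> I \<Longrightarrow> prob_space (M i)" and "I \<noteq> {}"
  shows "prob_space.indep_vars (Pi\<^sub>M I M) M (\<lambda>i \<omega>. \<omega> i) I"
proof -
  interpret prob_space "Pi\<^sub>M I M" by (intro prob_space_PiM M)
  have "distr (Pi\<^sub>M I M) (Pi\<^sub>M I M) (\<lambda>\<omega>. \<lambda>i\<in>I. \<omega> i) = distr (Pi\<^sub>M I M) (Pi\<^sub>M I M) (\<lambda>\<omega>. \<omega>)"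
    by (rule distr_cong) (auto simp: space_PiM PiE_def extensional_restrict)
  also have "\<dots> = Pi\<^sub>M I M" by simp
  also have "\<dots> = Pi\<^sub>M I (\<lambda>i. distr (Pi\<^sub>M I M) (M i) (\<lambda>\<omega>. \<omega> i))"
    by (intro PiM_cong distr_PiM_component[symmetric] M refl)
  finally show ?thesis
    by (subst indep_vars_iff_distr_eq_PiM'[OF \<open>I \<noteq> {}\<close>]) auto
qed

lemma borel_measurable_SUP_countable_image:
  fixes g :: "'b \<Rightarrow> 'a \<Rightarrow> real"
  assumes "countable (g ` I)" and [measurable]: "\<And>t. t \<in> I \<Longrightarrow> g t \<in> borel_measurable M"
  shows "(\<lambda>x. SUP t\<in>I. ereal (g t x + b t)) \<in> borel_measurable M"
proof -
  have "(SUP t\<in>I. ereal (g t x + b t)) =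
      (SUP h\<in>g ` I. ereal (h x) + (SUP t\<in>{t\<in>I. g t = h}. ereal (b t)))" for x
  proof -
    have "(SUP t\<in>I. ereal (g t x + b t)) =
        (SUP h\<in>g ` I. SUP t\<in>{t\<in>I. g t = h}. ereal (g t x + b t))"
      by (rule antisym) (auto intro!: SUP_least intro: SUP_upper SUP_upper2)
    also have "\<dots> = (SUP h\<in>g ` I. SUP t\<in>{t\<in>I. g t = h}. ereal (h x) + ereal (b t))"
      by (intro SUP_cong refl) auto
    also have "\<dots> = (SUP h\<in>g ` I. ereal (h x) + (SUP t\<in>{t\<in>I. g t = h}. ereal (b t)))"
      by (intro SUP_cong refl SUP_ereal_add_right) auto
    finally show ?thesis .
  qed
  moreover have "(\<lambda>x. SUP h\<in>g ` I. ereal (h x) + (SUP t\<in>{t\<in>I. g t = h}. ereal (b t)))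
      \<in> borel_measurable M"
    by (rule borel_measurable_SUP[OF assms(1)]) auto
  ultimately show ?thesis by simp
qed

section \<open>Quantiles of distribution functions\<close>

context real_distribution
begin

lemma prob_greaterThan: "prob {x<..} = 1 - cdf M x"
  using prob_compl[of "{..x}"] by (simp add: cdf_def Compl_eq_Diff_UNIV[symmetric])

lemma prob_atLeast: "prob {x..} = 1 - prob {..<x}"
  using prob_compl[of "{..<x}"] by (simp add: Compl_eq_Diff_UNIV[symmetric])

lemma prob_lessThan_eq_cdf:
  assumes "isCont (cdf M) x"
  shows "prob {..<x} = cdf M x"
proof (rule tendsto_unique[OF _ cdf_at_left])
  show "(cdf M \<longlongrightarrow> cdf M x) (at_left x)"
    using assms by (simp add: isCont_def filterlim_at_split)
qed simp

lemma quantile_cdf_le_iff: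
  assumes "0 < q" "q < 1"
  shows "quantile (cdf M) q \<le> x \<longleftrightarrow> q \<le> cdf M x"
proof
  let ?A = "{t. q \<le> cdf M t}"
  have "\<forall>\<^sub>F t in at_top. q < cdf M t"
    by (rule order_tendstoD(1)[OF cdf_lim_at_top_prob \<open>q < 1\<close>])
  then have nonempty: "?A \<noteq> {}"
    by (auto simp: eventually_at_top_linorder intro: less_imp_le)
  have "\<forall>\<^sub>F t in at_bot. cdf M t < q"
    by (rule order_tendstoD(2)[OF cdf_lim_at_bot \<open>0 < q\<close>])
  then obtain b where "cdf M t < q" if "t \<le> b" for t
    by (auto simp: eventually_at_bot_linorder)
  then have "bdd_below ?A"
    by (intro bdd_belowI[of _ b]) (meson linorder_le_cases mem_Collect_eq not_le)
  then show "q \<le> cdf M x \<Longrightarrow> quantile (cdf M) q \<le> x"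
    by (simp add: quantile_def cInf_lower)
  have "q \<le> cdf M (Inf ?A)"
  proof (rule tendsto_lowerbound)
    show "(cdf M \<longlongrightarrow> cdf M (Inf ?A)) (at_right (Inf ?A))"
      using cdf_is_right_cont by (simp add: continuous_within)
    show "\<forall>\<^sub>F y in at_right (Inf ?A). q \<le> cdf M y"
      using eventually_at_right_less
    proof eventually_elim
      case (elim y)
      then obtain a where "a \<in> ?A" "a < y"
        using cInf_lessD[OF nonempty] by blast
      then show ?case using cdf_nondecreasing[of a y] by simp
    qed
  qed simp
  then show "q \<le> cdf M x" if "quantile (cdf M) q \<le> x"
    using cdf_nondecreasing[OF that] by (simp add: quantile_def)
qed

lemma cdf_quantile:
  assumes q: "0 < q" "q < 1" and cont: "isCont (cdf M) (quantile (cdf M) q)"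
  shows "cdf M (quantile (cdf M) q) = q"
proof (rule antisym)
  let ?x = "quantile (cdf M) q"
  show "cdf M ?x \<le> q"
  proof (rule tendsto_upperbound)
    show "(cdf M \<longlongrightarrow> cdf M ?x) (at_left ?x)"
      using cont by (simp add: isCont_def filterlim_at_split)
    have "cdf M y \<le> q" if "y < ?x" for y
      using quantile_cdf_le_iff[OF q, of y] that by linarith
    then show "\<forall>\<^sub>F y in at_left ?x. cdf M y \<le> q"
      by (simp add: eventually_at_filter)
  qed simp
  show "q \<le> cdf M ?x"
    using quantile_cdf_le_iff[OF q] by blast
qed

lemma le_quantile_cdf_if_prob_lessThan_less:
  assumes "0 < q" "q < 1" "prob {..<x} < q"
  shows "x \<le> quantile (cdf M) q"
proof (rule ccontr)
  let ?y = "quantile (cdf M) q"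
  assume "\<not> x \<le> ?y"
  then have "prob {..?y} \<le> prob {..<x}"
    by (intro finite_measure_mono) auto
  moreover have "q \<le> prob {..?y}"
    using quantile_cdf_le_iff[OF assms(1,2)] by (auto simp: cdf_def)
  ultimately show False using assms(3) by simp
qed

lemma quantile_cdf_le_if_prob_greaterThan_le:
  assumes "0 < q" "q < 1" "prob {x<..} \<le> q"
  shows "quantile (cdf M) (1 - q) \<le> x"
  using assms by (simp add: quantile_cdf_le_iff prob_greaterThan)

lemma le_quantile_cdf_if_less_prob_atLeast:
  assumes "0 < q" "q < 1" "q < prob {x..}"
  shows "x \<le> quantile (cdf M) (1 - q)"
  using assms by (intro le_quantile_cdf_if_prob_lessThan_less) (auto simp: prob_atLeast)

end

section \<open>The standard normal distribution function\<close>

lemma has_real_derivative_cdf_density: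
  fixes f :: "real \<Rightarrow> real"
  assumes "real_distribution (density lborel f)"
    and nonneg: "\<And>x. 0 \<le> f x" and cont: "continuous_on UNIV f"
  shows "(cdf (density lborel f) has_real_derivative f x) (at x)"
proof -
  let ?D = "density lborel (\<lambda>x. ennreal (f x))"
  interpret D: real_distribution ?D by fact
  have increment: "cdf ?D (x - 1) + integral {x - 1..u} f = cdf ?D u" if "x - 1 < u" for u
  proof -
    have int: "set_integrable lborel {x - 1..u} f"
      using continuous_on_subset[OF cont] by (intro borel_integrable_atLeastAtMost') auto
    have [measurable]: "f \<in> borel_measurable borel"
      using cont by (rule borel_measurable_continuous_onI)
    have "emeasure ?D {x - 1<..u} = (\<integral>\<^sup>+y. ennreal (indicator {x - 1..u} y *\<^sub>R f y) \<partial>lborel)"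
      by (subst emeasure_density)
         (auto intro!: nn_integral_cong_AE eventually_mono[OF AE_lborel_singleton[of "x - 1"]]
            split: split_indicator)
    also have "\<dots> = ennreal (LINT y:{x - 1..u}|lborel. f y)"
      using int nonneg unfolding set_lebesgue_integral_def set_integrable_def
      by (intro nn_integral_eq_integral) (auto split: split_indicator)
    finally have "measure ?D {x - 1<..u} = (LINT y:{x - 1..u}|lborel. f y)"
      using nonneg by (simp add: measure_def set_lebesgue_integral_def)
    then show ?thesis
      using D.cdf_diff_eq[OF that] set_borel_integral_eq_integral(2)[OF int] by simp
  qed
  have "((\<lambda>u. integral {x - 1..u} f) has_real_derivative f x) (at x within {x - 1..x + 1})"
    using continuous_on_subset[OF cont] by (intro integral_has_real_derivative) auto
  then have "((\<lambda>u. cdf ?D (x - 1) + integral {x - 1..u} f) has_real_derivative f x) (at x)"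
    by (auto intro!: derivative_eq_intros simp: at_within_interior[of x "{x - 1..x + 1}"])
  moreover have "\<forall>\<^sub>F u in nhds x. u \<in> {x - 1<..}"
    by (rule eventually_nhds_in_open) auto
  then have "\<forall>\<^sub>F u in nhds x. cdf ?D (x - 1) + integral {x - 1..u} f = cdf ?D u"
    by eventually_elim (auto intro: increment)
  ultimately show ?thesis
    by (subst (asm) DERIV_cong_ev[OF refl _ refl])
qed

lemma has_real_derivative_Phi: "(\<Phi> has_real_derivative std_normal_density x) (at x)"
  unfolding \<Phi>_def
  by (rule has_real_derivative_cdf_density[OF real_dist_normal_dist])
     (auto simp: std_normal_density_def[abs_def] intro!: continuous_intros)

lemma isCont_Phi: "isCont \<Phi> x"
  using DERIV_isCont[OF has_real_derivative_Phi] .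

lemma strict_mono_Phi: "strict_mono \<Phi>"
proof (rule strict_monoI)
  show "\<Phi> x < \<Phi> y" if "x < y" for x y
    using that
  proof (rule DERIV_pos_imp_increasing)
    show "\<exists>y. (\<Phi> has_real_derivative y) (at x) \<and> 0 < y" for x
      using has_real_derivative_Phi normal_density_pos zero_less_one by blast
  qed
qed

lemma Phi_less_iff [simp]: "\<Phi> x < \<Phi> y \<longleftrightarrow> x < y"
  by (rule strict_mono_less[OF strict_mono_Phi])

lemma Phi_le_iff [simp]: "\<Phi> x \<le> \<Phi> y \<longleftrightarrow> x \<le> y"
  by (rule strict_mono_less_eq[OF strict_mono_Phi])

lemma tendsto_Phi_at_top: "(\<Phi> \<longlongrightarrow> 1) at_top"
  unfolding \<Phi>_def by (rule real_distribution.cdf_lim_at_top_prob[OF real_dist_normal_dist])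

lemma Phi_less_1 [simp]: "\<Phi> x < 1"
proof -
  have "\<Phi> x < \<Phi> (x + 1)" by simp
  also have "\<dots> \<le> 1"
    unfolding \<Phi>_def by (rule real_distribution.cdf_bounded_prob[OF real_dist_normal_dist])
  finally show ?thesis .
qed

lemma Phi_quantile:
  assumes "0 < q" "q < 1"
  shows "\<Phi> (quantile \<Phi> q) = q"
  using real_distribution.cdf_quantile[OF real_dist_normal_dist assms] isCont_Phi
  by (simp add: \<Phi>_def)

lemma ex_normal_tail_less:
  assumes "0 < e"
  shows "\<exists>x. 1 - \<Phi> x < e"
proof -
  have "\<forall>\<^sub>F x in at_top. 1 - e < \<Phi> x"
    using assms by (intro order_tendstoD(1)[OF tendsto_Phi_at_top]) simp
  then show ?thesis by (auto simp: eventually_at_top_linorder algebra_simps)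
qed

lemma density_normal_eq_distr_std_normal:
  assumes "c \<noteq> 0"
  shows "density lborel (normal_density \<mu> \<bar>c\<bar>) =
    distr std_normal_distribution borel (\<lambda>x. \<mu> + c * x)"
proof -
  interpret real_distribution std_normal_distribution by (rule real_dist_normal_dist)
  have "distributed std_normal_distribution lborel (\<lambda>x. x) std_normal_density"
    unfolding distributed_def by (auto intro!: measure_eqI simp: emeasure_distr)
  from normal_density_affine[OF this, of c \<mu>] assms show ?thesis
    by (simp add: distributed_def cong: distr_cong)
qed

lemma measure_normal_tails:
  fixes \<mu> \<sigma> x :: real
  assumes "0 < \<sigma>"
  defines "N \<equiv> density lborel (normal_density \<mu> \<sigma>)"
  shows "measure N {\<mu> + \<sigma> * x..} = 1 - \<Phi> x"
    and "measure N {\<mu> + \<sigma> * x<..} = 1 - \<Phi> x"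
    and "measure N {..\<mu> - \<sigma> * x} = 1 - \<Phi> x"
    and "measure N {..<\<mu> - \<sigma> * x} = 1 - \<Phi> x"
proof -
  interpret real_distribution std_normal_distribution by (rule real_dist_normal_dist)
  have std: "prob {y. x \<le> y} = 1 - \<Phi> x" "prob {y. x < y} = 1 - \<Phi> x"
    using prob_atLeast prob_greaterThan prob_lessThan_eq_cdf isCont_Phi
    by (auto simp: \<Phi>_def simp flip: atLeast_def greaterThan_def)
  have affine: "measure N A = prob ((\<lambda>x. \<mu> + c * x) -` A)"
    if "A \<in> sets borel" "\<bar>c\<bar> = \<sigma>" for A c
    using that assms density_normal_eq_distr_std_normal[of c \<mu>] by (auto simp: measure_distr)
  show "measure N {\<mu> + \<sigma> * x..} = 1 - \<Phi> x" "measure N {\<mu> + \<sigma> * x<..} = 1 - \<Phi> x"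
    using \<open>0 < \<sigma>\<close> by (simp_all add: affine[of _ \<sigma>] vimage_def std)
  show "measure N {..\<mu> - \<sigma> * x} = 1 - \<Phi> x" "measure N {..<\<mu> - \<sigma> * x} = 1 - \<Phi> x"
    using \<open>0 < \<sigma>\<close> by (simp_all add: affine[of _ "- \<sigma>"] vimage_def std)
qed

subsection \<open>Tail bounds\<close>

lemma has_real_derivative_std_normal_density:
  "(std_normal_density has_real_derivative - x * std_normal_density x) (at x)"
  unfolding std_normal_density_def[abs_def] by (rule derivative_eq_intros refl | simp)+

lemma std_normal_density_diff:
  "std_normal_density (x - h) = std_normal_density x * exp (x * h - h\<^sup>2 / 2)"
  by (simp add: std_normal_density_def power2_diff field_simps flip: exp_add)

lemma five_less_exp_mult:
  fixes u :: real
  assumes "0 < u" "u \<le> 0.8"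
  shows "5 < exp (2 - u) * (1 + u)"
proof -
  have "0 < u * (2 - 2.5 * u + u\<^sup>2 / 2)"
    using assms by (intro mult_pos_pos add_nonneg_pos) auto
  also have "\<dots> = (1 + (2 - u) + (2 - u)\<^sup>2 / 2) * (1 + u) - 5"
    by (simp add: power2_eq_square field_simps)
  also have "\<dots> \<le> exp (2 - u) * (1 + u) - 5"
    using assms by (intro diff_right_mono mult_right_mono exp_lower_Taylor_quadratic) auto
  finally show ?thesis by simp
qed

lemma five_mult_normal_tail_less:
  assumes "1.6 \<le> t"
  shows "5 * (1 - \<Phi> t) < 1 - \<Phi> (t - 2 / t)"
proof -
  let ?G = "\<lambda>y. (1 - \<Phi> (y - 2 / y)) - 5 * (1 - \<Phi> y)"
  have "0 < ?G t"
  proof (rule DERIV_neg_imp_decreasing_at_top[where f = ?G])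
    fix y assume "t \<le> y"
    then have y: "1.6 \<le> y" using assms by simp
    let ?u = "2 / y\<^sup>2"
    have "(?G has_real_derivative
        5 * std_normal_density y - std_normal_density (y - 2 / y) * (1 + ?u)) (at y)"
      using y by (auto intro!: derivative_eq_intros DERIV_chain2[of \<Phi>] has_real_derivative_Phi
          simp: power2_eq_square)
    moreover have "std_normal_density (y - 2 / y) = std_normal_density y * exp (2 - ?u)"
      using y by (simp add: std_normal_density_diff power_divide)
    moreover have "0 < ?u" "?u \<le> 0.8"
      using y power_mono[OF y, of 2] by (auto simp: field_simps power2_eq_square)
    then have "std_normal_density y * 5 < std_normal_density y * (exp (2 - ?u) * (1 + ?u))"
      by (intro mult_strict_left_mono five_less_exp_mult normal_density_pos) auto
    ultimately show "\<exists>D. (?G has_real_derivative D) (at y) \<and> D < 0"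
      by (auto simp: mult.assoc)
  next
    have "filterlim (\<lambda>y::real. y - 2 / y) at_top at_top" by real_asymp
    then have "((\<lambda>y. \<Phi> (y - 2 / y)) \<longlongrightarrow> 1) at_top"
      by (rule filterlim_compose[OF tendsto_Phi_at_top])
    then have "(?G \<longlongrightarrow> (1 - 1) - 5 * (1 - 1)) at_top"
      by (intro tendsto_intros tendsto_Phi_at_top)
    then show "(?G \<longlongrightarrow> 0) at_top" by simp
  qed
  then show ?thesis by simp
qed

lemma normal_tail_less_fifth:
  assumes "1.6 \<le> t"
  shows "1 - \<Phi> t < 1 / 5"
proof -
  have "0 \<le> \<Phi> (t - 2 / t)" by (simp add: \<Phi>_def cdf_def)
  then show ?thesis using five_mult_normal_tail_less[OF assms] by simp
qed

lemma less_normal_tail_if_mills_ratio: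
  assumes "\<And>y. x \<le> y \<Longrightarrow> (R has_real_derivative R' y) (at y)"
    and "\<And>y. x \<le> y \<Longrightarrow> y * R y - R' y < 1"
    and "((\<lambda>y. std_normal_density y * R y) \<longlongrightarrow> 0) at_top"
  shows "std_normal_density x * R x < 1 - \<Phi> x"
proof -
  let ?G = "\<lambda>y. (1 - \<Phi> y) - std_normal_density y * R y"
  have "0 < ?G x"
  proof (rule DERIV_neg_imp_decreasing_at_top[where f = ?G])
    fix y assume "x \<le> y"
    then have "(?G has_real_derivative - std_normal_density y * (1 - (y * R y - R' y))) (at y)"
      by (auto intro!: derivative_eq_intros has_real_derivative_Phi assms(1)
          has_real_derivative_std_normal_density simp: algebra_simps)
    moreover have "- std_normal_density y * (1 - (y * R y - R' y)) < 0"
      using assms(2)[OF \<open>x \<le> y\<close>] by (intro mult_neg_pos) (simp_all add: normal_density_pos)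
    ultimately show "\<exists>D. (?G has_real_derivative D) (at y) \<and> D < 0" by blast
  next
    have "(?G \<longlongrightarrow> (1 - 1) - 0) at_top"
      by (intro tendsto_intros tendsto_Phi_at_top assms(3))
    then show "(?G \<longlongrightarrow> 0) at_top" by simp
  qed
  then show ?thesis by simp
qed

text \<open>The simpler bound \<open>x / (x\<^sup>2 + 1)\<close> for the Mills ratio is too weak to give
  \<open>1 - \<Phi>(1.6) > 0.05\<close>.\<close>

lemma laplace_convergent_less_normal_tail:
  "std_normal_density x * ((x^3 + 5 * x) / (x^4 + 6 * x\<^sup>2 + 3)) < 1 - \<Phi> x"
proof (rule less_normal_tail_if_mills_ratio)
  fix y :: real
  let ?D = "y^4 + 6 * y\<^sup>2 + 3" and ?N = "y^3 + 5 * y"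
  have D: "0 < ?D" by (auto intro!: add_nonneg_pos add_nonneg_nonneg)
  then show "((\<lambda>y. (y^3 + 5 * y) / (y^4 + 6 * y\<^sup>2 + 3)) has_real_derivative
      ((3 * y\<^sup>2 + 5) * ?D - ?N * (4 * y^3 + 12 * y)) / ?D\<^sup>2) (at y)"
    by (auto intro!: derivative_eq_intros simp: power2_eq_square)
  have "y * ?N * ?D - ((3 * y\<^sup>2 + 5) * ?D - ?N * (4 * y^3 + 12 * y)) = ?D\<^sup>2 - 24"
    by algebra
  moreover have "y * (?N / ?D) = y * ?N * ?D / ?D\<^sup>2"
    using D by (simp add: power2_eq_square)
  ultimately have "y * (?N / ?D) - ((3 * y\<^sup>2 + 5) * ?D - ?N * (4 * y^3 + 12 * y)) / ?D\<^sup>2 =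
      (?D\<^sup>2 - 24) / ?D\<^sup>2"
    by (simp only: diff_divide_distrib[symmetric])
  then show "y * (?N / ?D) - ((3 * y\<^sup>2 + 5) * ?D - ?N * (4 * y^3 + 12 * y)) / ?D\<^sup>2 < 1"
    using D by (simp add: divide_less_eq)
next
  show "((\<lambda>y. std_normal_density y * ((y^3 + 5 * y) / (y^4 + 6 * y\<^sup>2 + 3))) \<longlongrightarrow> 0) at_top"
    unfolding std_normal_density_def by real_asymp
qed

lemma sqrt_two_pi_le: "sqrt (2 * pi) \<le> 2.51"
  using pi_approx by (intro real_le_lsqrt) (auto simp: power2_eq_square)

lemma normal_tail_1_6_greater: "0.052 < 1 - \<Phi> 1.6"
proof -
  have "(0.27::real) \<le> (1 + (- 0.04)) ^ 32" by (simp add: power_numeral_reduce)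
  also have "\<dots> \<le> exp (- 0.04) ^ 32"
    by (intro power_mono exp_ge_add_one_self) auto
  also have "\<dots> = exp (- 1.28)"
    by (simp flip: exp_of_nat_mult)
  finally have "0.27 / 2.51 \<le> exp (- 1.28) / sqrt (2 * pi)"
    using sqrt_two_pi_le by (intro frac_le) auto
  then have "0.27 / 2.51 \<le> std_normal_density 1.6"
    by (simp add: std_normal_density_def power2_eq_square)
  then have "0.27 / 2.51 * ((1.6^3 + 5 * 1.6) / (1.6^4 + 6 * 1.6\<^sup>2 + 3)) \<le>
      std_normal_density 1.6 * ((1.6^3 + 5 * 1.6) / (1.6^4 + 6 * 1.6\<^sup>2 + 3))"
    by (intro mult_right_mono) auto
  also have "\<dots> < 1 - \<Phi> 1.6" by (rule laplace_convergent_less_normal_tail)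
  finally show ?thesis by (simp add: power_numeral_reduce)
qed

lemma std_normal_density_antimono:
  assumes "0 \<le> x" "x \<le> y"
  shows "std_normal_density y \<le> std_normal_density x"
  using power_mono[OF assms(2,1), of 2] by (simp add: std_normal_density_def divide_right_mono)

lemma std_normal_density_less_normal_tail:
  assumes "0 \<le> t"
  shows "std_normal_density (t + 1) < 1 - \<Phi> t"
proof -
  obtain z where z: "t < z" "z < t + 1" "\<Phi> (t + 1) - \<Phi> t = std_normal_density z"
    using MVT2[of t "t + 1" \<Phi> std_normal_density] has_real_derivative_Phi by auto
  have "std_normal_density (t + 1) \<le> std_normal_density z"
    using z assms by (intro std_normal_density_antimono) auto
  also have "\<dots> < 1 - \<Phi> t"
    using z(3) Phi_less_1[of "t + 1"] by linarith
  finally show ?thesis .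
qed

lemma exp_less_normal_tail:
  assumes "1.4 \<le> t"
  shows "exp (- 2 * t\<^sup>2) < 1 - \<Phi> t"
proof -
  have "(1 + 1 / 2 + (1 / 2)\<^sup>2 / 2)\<^sup>2 \<le> (exp (1 / 2 :: real))\<^sup>2"
    by (intro power_mono exp_lower_Taylor_quadratic) auto
  also have "\<dots> = exp 1" by (simp flip: exp_double)
  finally have e: "sqrt (2 * pi) \<le> exp 1"
    using sqrt_two_pi_le by (simp add: power2_eq_square)
  have "0 \<le> (t - 1.4) * (1.5 * t + 1.1) + 0.04"
    using assms by (intro add_nonneg_nonneg mult_nonneg_nonneg) auto
  then have "(t + 1)\<^sup>2 / 2 + 1 \<le> 2 * t\<^sup>2"
    by (simp add: power2_eq_square field_simps)
  then have "exp (- 2 * t\<^sup>2) \<le> exp (- (t + 1)\<^sup>2 / 2 - 1)" by simp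
  also have "\<dots> = exp (- (t + 1)\<^sup>2 / 2) / exp 1" by (simp add: exp_diff)
  also have "\<dots> \<le> exp (- (t + 1)\<^sup>2 / 2) / sqrt (2 * pi)"
    using e by (intro divide_left_mono) auto
  also have "\<dots> = std_normal_density (t + 1)" by (simp add: std_normal_density_def)
  also have "\<dots> < 1 - \<Phi> t"
    using assms by (intro std_normal_density_less_normal_tail) simp
  finally show ?thesis .
qed

section \<open>The empirical measure and the interval\<close>

definition empirical_measure :: "nat \<Rightarrow> (nat \<Rightarrow> real) \<Rightarrow> real measure" where
  "empirical_measure n X = distr (measure_pmf (pmf_of_set {..<n})) borel X"

lemma real_distribution_empirical_measure: "real_distribution (empirical_measure n X)"
  unfolding empirical_measure_def
  by (rule prob_space.real_distribution_distr[OF prob_space_measure_pmf]) simp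

lemma measure_empirical_measure:
  assumes "n > 0" "A \<in> sets borel"
  shows "measure (empirical_measure n X) A = (\<Sum>i<n. indicator A (X i)) / real n"
proof -
  have "card ({..<n} \<inter> X -` A) = (\<Sum>i<n. indicator A (X i) :: real)"
    by (simp add: indicator_def sum.If_cases vimage_def)
  then show ?thesis
    using assms
    by (simp add: empirical_measure_def measure_distr measure_pmf_of_set lessThan_empty_iff)
qed

lemma cdf_empirical_measure:
  assumes "n > 0"
  shows "cdf (empirical_measure n X) = ecdf n X"
  using assms
  by (simp add: fun_eq_iff cdf_def ecdf_def measure_empirical_measure indicator_def of_bool_def)

lemma borel_measurable_empirical_measure:
  assumes "n > 0" and [measurable]: "A \<in> sets borel"
    and [measurable_cong]: "sets M = sets (Pi\<^sub>M {..<n} (\<lambda>_. borel))"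
  shows "(\<lambda>X. measure (empirical_measure n X) A) \<in> borel_measurable M"
  using assms(1) by (simp add: measure_empirical_measure)

lemma two_mult_normal_tail_bounds:
  assumes "1.6 \<le> t"
  shows "0 < 2 * (1 - \<Phi> t)" "2 * (1 - \<Phi> t) < 1"
  using normal_tail_less_fifth[OF assms] by simp_all

lemma mem_CI_if_tails_heavy:
  assumes n: "n > 0"
    and lower: "\<And>t. t \<in> {1.6..t_max n \<alpha>} \<Longrightarrow>
      2 * (1 - \<Phi> t) < measure (empirical_measure n X) {..\<theta> - (t - 2 / t)}"
    and upper: "\<And>t. t \<in> {1.6..t_max n \<alpha>} \<Longrightarrow>
      2 * (1 - \<Phi> t) < measure (empirical_measure n X) {\<theta> + (t - 2 / t)..}"
  shows "\<theta> \<in> CI n \<alpha> X"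
proof -
  interpret E: real_distribution "empirical_measure n X"
    by (rule real_distribution_empirical_measure)
  have "quantile (ecdf n X) (2 * (1 - \<Phi> t)) + t - 2 / t \<le> \<theta>"
    and "\<theta> \<le> quantile (ecdf n X) (1 - 2 * (1 - \<Phi> t)) - t + 2 / t"
    if t: "t \<in> {1.6..t_max n \<alpha>}" for t
  proof -
    note bounds = two_mult_normal_tail_bounds[of t]
    have "quantile (ecdf n X) (2 * (1 - \<Phi> t)) \<le> \<theta> - (t - 2 / t)"
      using E.quantile_cdf_le_iff[OF bounds] lower[OF t] t
      by (simp add: cdf_empirical_measure[OF n, symmetric] cdf_def)
    then show "quantile (ecdf n X) (2 * (1 - \<Phi> t)) + t - 2 / t \<le> \<theta>" by simp
    have "\<theta> + (t - 2 / t) \<le> quantile (ecdf n X) (1 - 2 * (1 - \<Phi> t))"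
      using E.le_quantile_cdf_if_less_prob_atLeast[OF bounds] upper[OF t] t
      by (simp add: cdf_empirical_measure[OF n])
    then show "\<theta> \<le> quantile (ecdf n X) (1 - 2 * (1 - \<Phi> t)) - t + 2 / t" by simp
  qed
  then show ?thesis
    by (auto simp: CI_def CI_lower_def CI_upper_def intro!: SUP_least INF_greatest)
qed

lemma CI_subset_if_tails_light:
  assumes n: "n > 0" and t: "t \<in> {1.6..t_max n \<alpha>}"
    and lower: "measure (empirical_measure n X) {..<\<theta> - K} < 2 * (1 - \<Phi> t)"
    and upper: "measure (empirical_measure n X) {\<theta> + K<..} \<le> 2 * (1 - \<Phi> t)"
  shows "CI n \<alpha> X \<subseteq> {\<theta> - K + (t - 2 / t)..\<theta> + K - (t - 2 / t)}"
proof
  interpret E: real_distribution "empirical_measure n X"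
    by (rule real_distribution_empirical_measure)
  note bounds = two_mult_normal_tail_bounds[of t]
  fix x assume x: "x \<in> CI n \<alpha> X"
  have "ereal (quantile (ecdf n X) (2 * (1 - \<Phi> t)) + t - 2 / t) \<le> CI_lower n \<alpha> X"
    unfolding CI_lower_def using t by (rule SUP_upper)
  also have "\<dots> \<le> ereal x" using x by (simp add: CI_def)
  finally have "quantile (ecdf n X) (2 * (1 - \<Phi> t)) + (t - 2 / t) \<le> x" by simp
  moreover have "\<theta> - K \<le> quantile (ecdf n X) (2 * (1 - \<Phi> t))"
    using E.le_quantile_cdf_if_prob_lessThan_less[OF bounds lower] t
    by (simp add: cdf_empirical_measure[OF n])
  moreover have "x \<le> quantile (ecdf n X) (1 - 2 * (1 - \<Phi> t)) - (t - 2 / t)"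
  proof -
    have "ereal x \<le> CI_upper n \<alpha> X" using x by (simp add: CI_def)
    also have "\<dots> \<le> ereal (quantile (ecdf n X) (1 - 2 * (1 - \<Phi> t)) - t + 2 / t)"
      unfolding CI_upper_def using t by (rule INF_lower)
    finally show ?thesis by simp
  qed
  moreover have "quantile (ecdf n X) (1 - 2 * (1 - \<Phi> t)) \<le> \<theta> + K"
    using E.quantile_cdf_le_if_prob_greaterThan_le[OF bounds upper] t
    by (simp add: cdf_empirical_measure[OF n])
  ultimately show "x \<in> {\<theta> - K + (t - 2 / t)..\<theta> + K - (t - 2 / t)}" by simp
qed

lemma emeasure_CI_le_if_tails_light:
  assumes "n > 0" "t \<in> {1.6..t_max n \<alpha>}"
    and "measure (empirical_measure n X) {..<\<theta> - K} < 2 * (1 - \<Phi> t)"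
    and "measure (empirical_measure n X) {\<theta> + K<..} \<le> 2 * (1 - \<Phi> t)"
  shows "emeasure lborel (CI n \<alpha> X) \<le> ennreal (2 * K - 2 * t + 4 / t)"
proof -
  have "emeasure lborel (CI n \<alpha> X) \<le>
      emeasure lborel {\<theta> - K + (t - 2 / t)..\<theta> + K - (t - 2 / t)}"
    using CI_subset_if_tails_light[OF assms] by (intro emeasure_mono) auto
  also have "\<dots> \<le> ennreal (2 * K - 2 * t + 4 / t)"
    by (auto simp: emeasure_lborel_Icc_eq intro!: ennreal_leI)
  finally show ?thesis .
qed

subsection \<open>Measurability\<close>

lemma quantile_ecdf_ceiling:
  assumes "n > 0"
  shows "quantile (ecdf n X) q = quantile (ecdf n X) (of_int \<lceil>real n * q\<rceil> / real n)"
proof -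
  have "q \<le> ecdf n X t \<longleftrightarrow> of_int \<lceil>real n * q\<rceil> / real n \<le> ecdf n X t" for t
  proof -
    define m where "m = (\<Sum>i<n. of_bool (X i \<le> t) :: int)"
    have m: "ecdf n X t = of_int m / real n" by (simp add: ecdf_def m_def)
    have "q \<le> ecdf n X t \<longleftrightarrow> real n * q \<le> of_int m"
      "of_int \<lceil>real n * q\<rceil> / real n \<le> ecdf n X t \<longleftrightarrow> real_of_int \<lceil>real n * q\<rceil> \<le> of_int m"
      unfolding m using assms by (auto simp: field_simps)
    then show ?thesis by (simp add: ceiling_le_iff)
  qed
  then show ?thesis by (simp add: quantile_def)
qed

lemma countable_range_quantile_ecdf:
  assumes "n > 0"
  shows "countable (range (\<lambda>q X. quantile (ecdf n X) q))"
proof (rule countable_subset)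
  show "range (\<lambda>q X. quantile (ecdf n X) q) \<subseteq>
      range (\<lambda>(k::int) X. quantile (ecdf n X) (of_int k / real n))"
    using quantile_ecdf_ceiling[OF assms] by (auto simp: fun_eq_iff)
qed simp

lemma borel_measurable_quantile_ecdf:
  assumes "n > 0" and M: "sets M = sets (Pi\<^sub>M {..<n} (\<lambda>_. borel))" and q: "0 < q" "q < 1"
  shows "(\<lambda>X. quantile (ecdf n X) q) \<in> borel_measurable M"
proof -
  note [measurable_cong] = M
  have "quantile (ecdf n X) q \<le> a \<longleftrightarrow> q \<le> ecdf n X a" for X a
    using real_distribution.quantile_cdf_le_iff[OF real_distribution_empirical_measure q]
    by (simp flip: cdf_empirical_measure[OF \<open>n > 0\<close>])
  moreover have "{X \<in> space M. q \<le> ecdf n X a} \<in> sets M" for a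
    unfolding ecdf_def by measurable
  ultimately show ?thesis by (simp add: borel_measurable_iff_le)
qed

text \<open>The endpoints are extrema over uncountably many \<open>t\<close>, but these involve only countably many
  distinct empirical quantile functions.\<close>

lemma borel_measurable_CI_lower:
  assumes "n > 0" and "sets M = sets (Pi\<^sub>M {..<n} (\<lambda>_. borel))"
  shows "CI_lower n \<alpha> \<in> borel_measurable M"
proof -
  let ?q = "\<lambda>t X. quantile (ecdf n X) (2 * (1 - \<Phi> t))"
  have "CI_lower n \<alpha> = (\<lambda>X. SUP t\<in>{1.6..t_max n \<alpha>}. ereal (?q t X + (t - 2 / t)))"
    by (simp add: CI_lower_def[abs_def] add_diff_eq)
  moreover have "countable (?q ` {1.6..t_max n \<alpha>})"
    by (rule countable_subset[OF _ countable_range_quantile_ecdf[OF assms(1)]]) auto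
  ultimately show ?thesis
    using borel_measurable_quantile_ecdf[OF assms] two_mult_normal_tail_bounds
    by (auto intro!: borel_measurable_SUP_countable_image)
qed

lemma borel_measurable_CI_upper:
  assumes "n > 0" and "sets M = sets (Pi\<^sub>M {..<n} (\<lambda>_. borel))"
  shows "CI_upper n \<alpha> \<in> borel_measurable M"
proof -
  let ?q = "\<lambda>t X. - quantile (ecdf n X) (1 - 2 * (1 - \<Phi> t))"
  have "CI_upper n \<alpha> = (\<lambda>X. - (SUP t\<in>{1.6..t_max n \<alpha>}. ereal (?q t X + (t - 2 / t))))"
    by (simp add: CI_upper_def[abs_def] algebra_simps flip: ereal_INF_uminus_eq)
  moreover have "countable (?q ` {1.6..t_max n \<alpha>})"
    by (rule countable_subset
        [OF _ countable_image[OF countable_range_quantile_ecdf[OF assms(1)], of "\<lambda>f X. - f X"]]) auto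
  then have "(\<lambda>X. SUP t\<in>{1.6..t_max n \<alpha>}. ereal (?q t X + (t - 2 / t))) \<in> borel_measurable M"
    using borel_measurable_quantile_ecdf[OF assms] two_mult_normal_tail_bounds
    by (intro borel_measurable_SUP_countable_image borel_measurable_uminus) auto
  ultimately show ?thesis by (simp only: borel_measurable_uminus_ereal)
qed

lemma sets_mem_CI:
  assumes "n > 0" and "sets M = sets (Pi\<^sub>M {..<n} (\<lambda>_. borel))"
  shows "{X \<in> space M. \<theta> \<in> CI n \<alpha> X} \<in> sets M"
proof -
  note [measurable] = borel_measurable_CI_lower[OF assms] borel_measurable_CI_upper[OF assms]
  show ?thesis unfolding CI_def by simp
qed

lemma sets_length_CI_le:
  assumes "n > 0" and "sets M = sets (Pi\<^sub>M {..<n} (\<lambda>_. borel))"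
  shows "{X \<in> space M. emeasure lborel (CI n \<alpha> X) \<le> c} \<in> sets M"
proof -
  note [measurable] = borel_measurable_CI_lower[OF assms] borel_measurable_CI_upper[OF assms]
  let ?R = "{p \<in> space (M \<Otimes>\<^sub>M lborel). snd p \<in> CI n \<alpha> (fst p)}"
  have "?R \<in> sets (M \<Otimes>\<^sub>M lborel)" unfolding CI_def mem_Collect_eq by measurable
  then have [measurable]: "(\<lambda>X. emeasure lborel (Pair X -` ?R)) \<in> borel_measurable M"
    by (rule lborel.measurable_emeasure_Pair)
  have "{X \<in> space M. emeasure lborel (Pair X -` ?R) \<le> c} \<in> sets M" by measurable
  moreover have "Pair X -` ?R = CI n \<alpha> X" if "X \<in> space M" for X
    using that by (auto simp: space_pair_measure)
  ultimately show ?thesis by (simp cong: conj_cong)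
qed

section \<open>Deviations of the empirical measure\<close>

lemma Hoeffding_PiM_indicator:
  fixes n :: nat
  assumes P: "prob_space P" and A [measurable]: "A \<in> sets P" and n: "n > 0" and "\<eta> \<ge> 0"
  defines "S \<equiv> Pi\<^sub>M {..<n} (\<lambda>_. P)"
  shows "measure S {X \<in> space S. measure P A + \<eta> \<le> (\<Sum>i<n. indicator A (X i)) / real n}
      \<le> exp (- 2 * real n * \<eta>\<^sup>2)" (is ?upper)
    and "measure S {X \<in> space S. (\<Sum>i<n. indicator A (X i)) / real n \<le> measure P A - \<eta>}
      \<le> exp (- 2 * real n * \<eta>\<^sup>2)" (is ?lower)
proof -
  interpret S: prob_space S unfolding S_def by (intro prob_space_PiM P)
  have comp: "distr S P (\<lambda>X. X i) = P" if "i < n" for i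
    unfolding S_def using that P by (intro distr_PiM_component) auto
  have comp_measurable [measurable]: "(\<lambda>X. X i) \<in> measurable S P" if "i < n" for i
    unfolding S_def using that by (intro measurable_component_singleton) simp
  have distr: "distr S borel (\<lambda>X. indicator A (X i) :: real) = distr P borel (indicator A)"
    if "i < n" for i
  proof -
    have "distr S borel (\<lambda>X. indicator A (X i) :: real) =
        distr (distr S P (\<lambda>X. X i)) borel (indicator A)"
      using that by (subst distr_distr) (auto simp: comp_def)
    then show ?thesis using comp[OF that] by simp
  qed
  have "S.expectation (\<lambda>X. indicator A (X 0) :: real) =
      integral\<^sup>L (distr S P (\<lambda>X. X 0)) (indicator A)"
    using n by (subst integral_distr) auto
  then have mean: "S.expectation (\<lambda>X. indicator A (X 0) :: real) = measure P A"
    using comp[OF n] by simp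
  interpret H: Hoeffding_ineq_iid S "{..<n}" "\<lambda>i X. indicator A (X i)" "\<lambda>X. indicator A (X 0)" 0 1
    "measure P A"
  proof unfold_locales
    have "S.indep_vars (\<lambda>_. P) (\<lambda>i X. X i) {..<n}"
      unfolding S_def using P n by (intro indep_vars_PiM_component) auto
    then show "S.indep_vars (\<lambda>_. borel) (\<lambda>i X. indicator A (X i) :: real) {..<n}"
      by (rule S.indep_vars_compose2) auto
  qed (use n distr mean in \<open>auto split: split_indicator\<close>)
  show ?upper ?lower
    using H.Hoeffding_ineq_ge'[of \<eta>] H.Hoeffding_ineq_le'[of \<eta>] assms by auto
qed

lemma exp_minus_geometric_le:
  fixes c :: real
  assumes "0 \<le> c"
  shows "exp (- (c * ((3 / 2) ^ Suc k)\<^sup>2)) \<le> exp (- c) ^ (k + 2)"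
proof -
  have "real (k + 2) \<le> 1 + real (Suc k) * (5 / 4)" by simp
  also have "\<dots> \<le> (1 + 5 / 4) ^ Suc k" by (rule Bernoulli_inequality) simp
  also have "\<dots> = ((3 / 2) ^ Suc k)\<^sup>2"
    by (simp add: power2_eq_square flip: power_mult_distrib)
  finally have "c * real (k + 2) \<le> c * ((3 / 2) ^ Suc k)\<^sup>2"
    using assms by (rule mult_left_mono)
  then have "exp (- (c * ((3 / 2) ^ Suc k)\<^sup>2)) \<le> exp (real (k + 2) * - c)"
    by (simp add: mult.commute)
  then show ?thesis by (simp only: exp_of_nat_mult)
qed

locale iid_sample = real_distribution P for P :: "real measure" +
  fixes n :: nat
  assumes n_pos: "n > 0"
begin

abbreviation S :: "(nat \<Rightarrow> real) measure" where
  "S \<equiv> Pi\<^sub>M {..<n} (\<lambda>_. P)"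

abbreviation emp :: "(nat \<Rightarrow> real) \<Rightarrow> real set \<Rightarrow> real" where
  "emp X \<equiv> measure (empirical_measure n X)"

sublocale S: prob_space S
  by (intro prob_space_PiM prob_space_axioms)

lemma sets_S: "sets S = sets (Pi\<^sub>M {..<n} (\<lambda>_. borel))"
  by (intro sets_PiM_cong) auto

lemma borel_measurable_emp [measurable]:
  "A \<in> sets borel \<Longrightarrow> (\<lambda>X. emp X A) \<in> borel_measurable S"
  by (rule borel_measurable_empirical_measure[OF n_pos _ sets_S])

lemma prob_emp_deviation:
  assumes "A \<in> sets borel" "0 \<le> \<eta>"
  shows "S.prob {X \<in> space S. prob A + \<eta> \<le> emp X A} \<le> exp (- 2 * real n * \<eta>\<^sup>2)"
    and "S.prob {X \<in> space S. emp X A \<le> prob A - \<eta>} \<le> exp (- 2 * real n * \<eta>\<^sup>2)"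
  using Hoeffding_PiM_indicator[OF prob_space_axioms _ n_pos assms(2)] assms(1)
  by (simp_all add: measure_empirical_measure[OF n_pos])

lemma prob_emp_deviation_geometric:
  fixes A :: "nat \<Rightarrow> real set"
  assumes A: "\<And>k. A k \<in> sets borel" and "0 \<le> \<delta>"
  defines "\<beta> \<equiv> exp (- 2 * real n * \<delta>\<^sup>2)"
  assumes "\<beta> \<le> 1 / 2"
  shows "S.prob {X \<in> space S. \<exists>k. emp X (A k) \<le> prob (A k) - \<delta> * (3 / 2) ^ Suc k} \<le> \<beta>"
proof -
  let ?B = "\<lambda>k. {X \<in> space S. emp X (A k) \<le> prob (A k) - \<delta> * (3 / 2) ^ Suc k}"
  have B_prob: "S.prob (?B k) \<le> \<beta>\<^sup>2 * \<beta> ^ k" for k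
  proof -
    have "S.prob (?B k) \<le> exp (- (2 * real n * \<delta>\<^sup>2 * ((3 / 2) ^ Suc k)\<^sup>2))"
      using prob_emp_deviation(2)[OF A, of "\<delta> * (3 / 2) ^ Suc k" k] \<open>0 \<le> \<delta>\<close>
      by (simp add: power_mult_distrib mult.assoc del: power_Suc)
    also have "\<dots> \<le> exp (- (2 * real n * \<delta>\<^sup>2)) ^ (k + 2)"
      by (intro exp_minus_geometric_le) simp
    also have "\<dots> = \<beta>\<^sup>2 * \<beta> ^ k" by (simp add: \<beta>_def power_add power2_eq_square)
    finally show ?thesis .
  qed
  have \<beta>: "0 < \<beta>" "\<beta> < 1"
    using \<open>\<beta> \<le> 1 / 2\<close> unfolding \<beta>_def by (simp, linarith)
  have sums: "(\<lambda>k. \<beta>\<^sup>2 * \<beta> ^ k) sums (\<beta>\<^sup>2 * (1 / (1 - \<beta>)))"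
    using \<beta> by (intro sums_mult geometric_sums) simp
  have summable: "summable (\<lambda>k. S.prob (?B k))"
    by (rule summable_comparison_test'[OF sums_summable[OF sums]]) (use B_prob in simp)
  have "{X \<in> space S. \<exists>k. emp X (A k) \<le> prob (A k) - \<delta> * (3 / 2) ^ Suc k} = (\<Union>k. ?B k)" by auto
  also have "S.prob (\<Union>k. ?B k) \<le> (\<Sum>k. S.prob (?B k))"
  proof (rule S.finite_measure_subadditive_countably[OF _ summable])
    note [measurable] = A
    show "range ?B \<subseteq> S.events" by auto
  qed
  also have "\<dots> \<le> \<beta>\<^sup>2 * (1 / (1 - \<beta>))"
    unfolding sums_unique[OF sums] by (intro suminf_le B_prob summable sums_summable[OF sums])
  also have "\<dots> = \<beta> * (\<beta> / (1 - \<beta>))" by (simp add: power2_eq_square)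
  also have "\<dots> \<le> \<beta> * 1"
    using \<beta> \<open>\<beta> \<le> 1 / 2\<close> by (intro mult_left_mono) auto
  finally show ?thesis by simp
qed

end

section \<open>Coverage\<close>

definition radius :: "nat \<Rightarrow> real \<Rightarrow> real" where
  "radius n \<alpha> = sqrt (ln (2 / \<alpha>) / (2 * real n))"

lemma radius_squared:
  assumes "0 < \<alpha>" "\<alpha> \<le> 2"
  shows "(radius n \<alpha>)\<^sup>2 = ln (2 / \<alpha>) / (2 * real n)"
  using assms by (simp add: radius_def)

lemma measure_contaminated_normal:
  assumes "real_distribution Q" "A \<in> sets borel" "0 \<le> \<epsilon>" "\<epsilon> \<le> 1"
  shows "measure (contaminated_normal \<epsilon> \<theta> Q) A =
    (1 - \<epsilon>) * measure (density lborel (normal_density \<theta> 1)) A + \<epsilon> * measure Q A"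
proof -
  interpret Q: real_distribution Q by fact
  interpret N: prob_space "density lborel (normal_density \<theta> 1)"
    by (rule prob_space_normal_density) simp
  show ?thesis
    using assms
    by (simp add: measure_def[of "contaminated_normal \<epsilon> \<theta> Q"] emeasure_contaminated_normal
        N.emeasure_eq_measure Q.emeasure_eq_measure flip: ennreal_mult ennreal_plus)
qed

lemma measure_contaminated_normal_bounds:
  fixes \<epsilon> \<theta> :: real
  assumes "real_distribution Q" "A \<in> sets borel" "0 \<le> \<epsilon>" "\<epsilon> \<le> 1"
  defines "p \<equiv> measure (density lborel (normal_density \<theta> 1)) A"
  shows "(1 - \<epsilon>) * p \<le> measure (contaminated_normal \<epsilon> \<theta> Q) A"
    and "measure (contaminated_normal \<epsilon> \<theta> Q) A \<le> p + \<epsilon>"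
proof -
  interpret Q: real_distribution Q by fact
  note eq = measure_contaminated_normal[OF assms(1-4), of \<theta>, folded p_def]
  show "(1 - \<epsilon>) * p \<le> measure (contaminated_normal \<epsilon> \<theta> Q) A"
    using \<open>0 \<le> \<epsilon>\<close> by (simp add: eq)
  have "\<epsilon> * Q.prob A \<le> \<epsilon> * 1" using \<open>0 \<le> \<epsilon>\<close> by (intro mult_left_mono) auto
  moreover have "(1 - \<epsilon>) * p \<le> 1 * p"
    using \<open>0 \<le> \<epsilon>\<close> by (intro mult_right_mono) (auto simp: p_def)
  ultimately show "measure (contaminated_normal \<epsilon> \<theta> Q) A \<le> p + \<epsilon>"
    by (simp add: eq)
qed

locale contaminated_sample =
  fixes n :: nat and \<alpha> \<epsilon> \<theta> :: real and Q :: "real measure"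
  assumes sample_nonempty: "n > 0" and \<alpha>: "0 < \<alpha>" "\<alpha> < 1" and \<epsilon>: "0 \<le> \<epsilon>" "\<epsilon> \<le> 0.05"
    and Q: "real_distribution Q" and radius_less_1: "radius n \<alpha> < 1"
begin

sublocale iid_sample "contaminated_normal \<epsilon> \<theta> Q" n
  using Q \<epsilon> sample_nonempty
  by (auto simp: iid_sample_def iid_sample_axioms_def intro!: real_distribution_contaminated_normal)

abbreviation \<delta> :: real where
  "\<delta> \<equiv> radius n \<alpha>"

abbreviation gauss :: "real set \<Rightarrow> real" where
  "gauss \<equiv> measure (density lborel (normal_density \<theta> 1))"

lemma radius_pos: "0 < \<delta>"
  using n_pos \<alpha> by (simp add: radius_def)

lemma le_t_max_iff: "t \<le> t_max n \<alpha> \<longleftrightarrow> \<delta> \<le> 1 - \<Phi> t"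
proof -
  have "\<Phi> (t_max n \<alpha>) = 1 - \<delta>"
    using radius_pos radius_less_1 unfolding t_max_def radius_def[symmetric]
    by (intro Phi_quantile) auto
  then show ?thesis using Phi_le_iff[of t "t_max n \<alpha>"] by linarith
qed

lemma exp_radius: "exp (- 2 * real n * \<delta>\<^sup>2) = \<alpha> / 2"
proof -
  have "- 2 * real n * \<delta>\<^sup>2 = ln (\<alpha> / 2)"
    using n_pos \<alpha> by (simp add: radius_squared ln_div)
  then show ?thesis using \<alpha> by simp
qed

text \<open>For large \<open>k\<close>, where \<open>\<delta> (3/2)\<^sup>k \<ge> 1\<close>, the number \<open>node k\<close> is meaningless; the union bound
  over all \<open>k\<close> holds regardless.\<close>

definition node :: "nat \<Rightarrow> real" where
  "node k = quantile \<Phi> (1 - \<delta> * (3 / 2) ^ k)"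

definition lower_tail :: "nat \<Rightarrow> real set" where
  "lower_tail k = {..\<theta> - (node k - 2 / node k)}"

definition upper_tail :: "nat \<Rightarrow> real set" where
  "upper_tail k = {\<theta> + (node k - 2 / node k)..}"

definition deviates :: "(nat \<Rightarrow> real set) \<Rightarrow> (nat \<Rightarrow> real) \<Rightarrow> bool" where
  "deviates A X \<longleftrightarrow> (\<exists>k. emp X (A k) \<le> prob (A k) - \<delta> * (3 / 2) ^ Suc k)"

lemma borel_tails [measurable]: "lower_tail k \<in> sets borel" "upper_tail k \<in> sets borel"
  by (simp_all add: lower_tail_def upper_tail_def)

lemma gauss_tails:
  "gauss (lower_tail k) = 1 - \<Phi> (node k - 2 / node k)"
  "gauss (upper_tail k) = 1 - \<Phi> (node k - 2 / node k)"
  using measure_normal_tails(1,3)[of 1 \<theta> "node k - 2 / node k"]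
  by (simp_all add: lower_tail_def upper_tail_def)

lemma obtain_node:
  assumes "1.6 \<le> t" "t \<le> t_max n \<alpha>"
  obtains k where "t \<le> node k" "1 - \<Phi> t < 3 / 2 * (1 - \<Phi> (node k))"
    "1 - \<Phi> (node k) = \<delta> * (3 / 2) ^ k"
proof -
  have "\<delta> \<le> 1 - \<Phi> t" using assms(2) by (simp only: le_t_max_iff)
  then obtain k where k: "\<delta> * (3 / 2) ^ k \<le> 1 - \<Phi> t" "1 - \<Phi> t < \<delta> * (3 / 2) ^ Suc k"
    using ex_geometric_scale[OF radius_pos, of "1 - \<Phi> t" "3 / 2"] by auto
  moreover have "0 < \<delta> * (3 / 2) ^ k" using radius_pos by simp
  ultimately have "1 - \<Phi> (node k) = \<delta> * (3 / 2) ^ k"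
    using normal_tail_less_fifth[OF assms(1)] by (simp add: node_def Phi_quantile)
  moreover from this k(1) have "t \<le> node k"
    using Phi_le_iff[of t "node k"] by linarith
  ultimately show ?thesis using k by (intro that[of k]) auto
qed

lemma tail_heavy_if_not_deviates:
  assumes "\<not> deviates A X" "A k \<in> sets borel" "gauss (A k) = 1 - \<Phi> (node k - 2 / node k)"
    and "1.6 \<le> node k" "1 - \<Phi> (node k) = \<delta> * (3 / 2) ^ k"
  shows "3 * (1 - \<Phi> (node k)) < emp X (A k)"
proof -
  have "5 * (1 - \<Phi> (node k)) < gauss (A k)"
    using five_mult_normal_tail_less[OF assms(4)] assms(3) by simp
  moreover have "0.95 * gauss (A k) \<le> (1 - \<epsilon>) * gauss (A k)"
    using \<epsilon> by (intro mult_right_mono) auto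
  moreover have "(1 - \<epsilon>) * gauss (A k) \<le> prob (A k)"
    using Q assms(2) \<epsilon> by (intro measure_contaminated_normal_bounds) auto
  ultimately have "19 / 4 * (1 - \<Phi> (node k)) < prob (A k)" by simp
  moreover have "prob (A k) - 3 / 2 * (1 - \<Phi> (node k)) < emp X (A k)"
    using assms(1,5) by (simp add: deviates_def not_le mult_ac)
  ultimately show ?thesis using Phi_less_1[of "node k"] by argo
qed

lemma mem_CI_if_not_deviates:
  assumes "\<not> deviates lower_tail X" "\<not> deviates upper_tail X"
  shows "\<theta> \<in> CI n \<alpha> X"
proof -
  interpret E: real_distribution "empirical_measure n X"
    by (rule real_distribution_empirical_measure)
  have "2 * (1 - \<Phi> t) < emp X {..\<theta> - (t - 2 / t)} \<and> 2 * (1 - \<Phi> t) < emp X {\<theta> + (t - 2 / t)..}"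
    if "t \<in> {1.6..t_max n \<alpha>}" for t
  proof -
    from that have t: "1.6 \<le> t" "t \<le> t_max n \<alpha>" by auto
    obtain k where k: "t \<le> node k" "1 - \<Phi> t < 3 / 2 * (1 - \<Phi> (node k))"
      "1 - \<Phi> (node k) = \<delta> * (3 / 2) ^ k"
      by (rule obtain_node[OF t])
    have node: "1.6 \<le> node k" using t(1) k(1) by linarith
    have "t - 2 / t \<le> node k - 2 / node k"
      using t k(1) by (intro diff_mono divide_left_mono) auto
    then have "lower_tail k \<subseteq> {..\<theta> - (t - 2 / t)}" "upper_tail k \<subseteq> {\<theta> + (t - 2 / t)..}"
      by (auto simp: lower_tail_def upper_tail_def)
    then have "emp X (lower_tail k) \<le> emp X {..\<theta> - (t - 2 / t)}"
      and "emp X (upper_tail k) \<le> emp X {\<theta> + (t - 2 / t)..}"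
      by (auto intro!: E.finite_measure_mono)
    moreover have "3 * (1 - \<Phi> (node k)) < emp X (lower_tail k)"
      by (rule tail_heavy_if_not_deviates[OF assms(1) borel_tails(1) gauss_tails(1) node k(3)])
    moreover have "3 * (1 - \<Phi> (node k)) < emp X (upper_tail k)"
      by (rule tail_heavy_if_not_deviates[OF assms(2) borel_tails(2) gauss_tails(2) node k(3)])
    ultimately show ?thesis using k(2) by argo
  qed
  then show ?thesis using n_pos by (intro mem_CI_if_tails_heavy) auto
qed

lemma prob_deviates:
  assumes [measurable]: "\<And>k. A k \<in> sets borel"
  shows "{X \<in> space S. deviates A X} \<in> S.events" "S.prob {X \<in> space S. deviates A X} \<le> \<alpha> / 2"
proof -
  show "{X \<in> space S. deviates A X} \<in> S.events"
    unfolding deviates_def by measurable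
  show "S.prob {X \<in> space S. deviates A X} \<le> \<alpha> / 2"
    using prob_emp_deviation_geometric[of A \<delta>] assms radius_pos \<alpha> exp_radius
    by (simp add: deviates_def)
qed

lemma prob_mem_CI: "1 - \<alpha> \<le> \<P>(X in sampling n \<epsilon> \<theta> Q. \<theta> \<in> CI n \<alpha> X)"
  unfolding sampling_def
proof (rule S.prob_ge_if_two_bad_events)
  let ?B = "\<lambda>A. {X \<in> space S. deviates A X}"
  show "?B lower_tail \<in> S.events" "?B upper_tail \<in> S.events"
    and "S.prob (?B lower_tail) \<le> \<alpha> / 2" "S.prob (?B upper_tail) \<le> \<alpha> / 2"
    by (intro prob_deviates borel_tails)+
  show "{X \<in> space S. \<theta> \<in> CI n \<alpha> X} \<in> S.events"
    by (rule sets_mem_CI[OF n_pos sets_S])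
  show "space S - (?B lower_tail \<union> ?B upper_tail) \<subseteq> {X \<in> space S. \<theta> \<in> CI n \<alpha> X}"
    using mem_CI_if_not_deviates by blast
qed

section \<open>Length\<close>

lemma prob_length_le:
  assumes t: "1.6 \<le> t" "t \<le> t_max n \<alpha>" and K: "\<epsilon> + (1 - \<Phi> K) + \<delta> \<le> 2 * (1 - \<Phi> t)"
    and c: "2 * K - 2 * t + 4 / t \<le> c"
  shows "1 - \<alpha> \<le> \<P>(X in sampling n \<epsilon> \<theta> Q. emeasure lborel (CI n \<alpha> X) \<le> ennreal c)"
  unfolding sampling_def
proof (rule S.prob_ge_if_two_bad_events)
  let ?lo = "{..<\<theta> - K}" and ?hi = "{\<theta> + K<..}"
  let ?B = "\<lambda>A. {X \<in> space S. prob A + \<delta> \<le> emp X A}"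
  show "?B ?lo \<in> S.events" "?B ?hi \<in> S.events" by measurable
  show "S.prob (?B ?lo) \<le> \<alpha> / 2" "S.prob (?B ?hi) \<le> \<alpha> / 2"
    unfolding exp_radius[symmetric] by (rule prob_emp_deviation(1); use radius_pos in simp)+
  show "{X \<in> space S. emeasure lborel (CI n \<alpha> X) \<le> ennreal c} \<in> S.events"
    by (rule sets_length_CI_le[OF n_pos sets_S])
  have prob_le: "prob ?lo + \<delta> \<le> 2 * (1 - \<Phi> t)" "prob ?hi + \<delta> \<le> 2 * (1 - \<Phi> t)"
    using measure_contaminated_normal_bounds(2)[OF Q, of ?lo \<epsilon> \<theta>]
      measure_contaminated_normal_bounds(2)[OF Q, of ?hi \<epsilon> \<theta>]
      measure_normal_tails(2,4)[of 1 \<theta> K] K \<epsilon>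
    by auto
  show "space S - (?B ?lo \<union> ?B ?hi) \<subseteq> {X \<in> space S. emeasure lborel (CI n \<alpha> X) \<le> ennreal c}"
  proof
    fix X assume "X \<in> space S - (?B ?lo \<union> ?B ?hi)"
    then have "X \<in> space S" "emp X ?lo < 2 * (1 - \<Phi> t)" "emp X ?hi < 2 * (1 - \<Phi> t)"
      using prob_le by auto
    then have "emeasure lborel (CI n \<alpha> X) \<le> ennreal (2 * K - 2 * t + 4 / t)"
      using t n_pos by (intro emeasure_CI_le_if_tails_light) auto
    also have "\<dots> \<le> ennreal c" using c by (rule ennreal_leI)
    finally show "X \<in> {X \<in> space S. emeasure lborel (CI n \<alpha> X) \<le> ennreal c}"
      using \<open>X \<in> space S\<close> by simp
  qed
qed

lemma prob_length_le_const:
  assumes "1.6 \<le> t_max n \<alpha>" "1 - \<Phi> K \<le> 0.002" "2 * K \<le> c"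
  shows "1 - \<alpha> \<le> \<P>(X in sampling n \<epsilon> \<theta> Q. emeasure lborel (CI n \<alpha> X) \<le> ennreal c)"
proof (rule prob_length_le)
  have "\<delta> \<le> 1 - \<Phi> 1.6" using assms(1) by (simp only: le_t_max_iff)
  then show "\<epsilon> + (1 - \<Phi> K) + \<delta> \<le> 2 * (1 - \<Phi> 1.6)"
    using \<epsilon> assms(2) normal_tail_1_6_greater by simp
qed (use assms(1,3) in auto)

end

lemma inv_sqrt_log_inv_mono:
  assumes "0 \<le> x" "x \<le> y" "y < 1"
  shows "inv_sqrt_log_inv x \<le> inv_sqrt_log_inv y"
proof (cases "x = 0")
  case False
  then have "0 < ln (1 / y)" "ln (1 / y) \<le> ln (1 / x)"
    using assms by (auto simp: frac_le)
  then show ?thesis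
    using False assms by (auto simp: inv_sqrt_log_inv_def frac_le)
qed (use assms in \<open>simp add: inv_sqrt_log_inv_def\<close>)

lemma inv_sqrt_log_inv_nonneg: "0 \<le> x \<Longrightarrow> x < 1 \<Longrightarrow> 0 \<le> inv_sqrt_log_inv x"
  using inv_sqrt_log_inv_mono[of 0 x] by (simp add: inv_sqrt_log_inv_def)

definition rate :: "nat \<Rightarrow> real \<Rightarrow> real" where
  "rate n \<epsilon> = 1 / sqrt (ln (real n)) + inv_sqrt_log_inv \<epsilon>"

lemma inv_sqrt_log_inv_le_rate:
  assumes "2 \<le> n" "0 \<le> \<epsilon>" "\<epsilon> < 1" "0 \<le> y" "y \<le> 1 / real n \<or> y \<le> \<epsilon>"
  shows "inv_sqrt_log_inv y \<le> rate n \<epsilon>"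
proof -
  have "rate n \<epsilon> = inv_sqrt_log_inv (1 / real n) + inv_sqrt_log_inv \<epsilon>"
    using assms(1) by (simp add: rate_def inv_sqrt_log_inv_def)
  moreover have "0 \<le> inv_sqrt_log_inv (1 / real n)" "0 \<le> inv_sqrt_log_inv \<epsilon>"
    using assms by (simp_all add: inv_sqrt_log_inv_nonneg)
  moreover have "inv_sqrt_log_inv y \<le> inv_sqrt_log_inv (1 / real n) \<or>
      inv_sqrt_log_inv y \<le> inv_sqrt_log_inv \<epsilon>"
    using assms by (auto intro: inv_sqrt_log_inv_mono)
  ultimately show ?thesis by linarith
qed

lemma inverse_le_inv_sqrt_log_inv_normal_tail:
  assumes "1.6 \<le> t"
  shows "1 / t \<le> 3 * inv_sqrt_log_inv ((1 - \<Phi> t) ^ 4)"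
proof -
  let ?s = "1 - \<Phi> t"
  have s: "0 < ?s" "?s < 1 / 5" using normal_tail_less_fifth[OF assms] by simp_all
  have "ln (exp (- 2 * t\<^sup>2)) < ln ?s"
    using exp_less_normal_tail[of t] assms s by (subst ln_less_cancel_iff) auto
  moreover have ln: "ln (1 / ?s ^ 4) = - 4 * ln ?s"
    using s by (simp add: ln_div ln_realpow)
  ultimately have "ln (1 / ?s ^ 4) \<le> 8 * t\<^sup>2" by simp
  also have "\<dots> \<le> (3 * t)\<^sup>2" by (simp add: power_mult_distrib)
  finally have "sqrt (ln (1 / ?s ^ 4)) \<le> 3 * t"
    using assms by (intro real_le_lsqrt) auto
  moreover have "0 < sqrt (ln (1 / ?s ^ 4))" unfolding ln using s by simp
  ultimately have "1 / (3 * t) \<le> 1 / sqrt (ln (1 / ?s ^ 4))"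
    using assms by (intro divide_left_mono mult_pos_pos) auto
  then show ?thesis using less_imp_neq[OF s(1)] by (simp add: inv_sqrt_log_inv_def)
qed

lemma two_mult_radius_power4_le:
  assumes "0 < \<alpha>" "\<alpha> \<le> 2" "n > 0" "4 * (ln (2 / \<alpha>))\<^sup>2 \<le> real n"
  shows "(2 * radius n \<alpha>) ^ 4 \<le> 1 / real n"
proof -
  have "(2 * radius n \<alpha>) ^ 4 = (4 * (radius n \<alpha>)\<^sup>2)\<^sup>2"
    by (simp add: power_mult_distrib flip: power_mult)
  also have "\<dots> = 4 * (ln (2 / \<alpha>))\<^sup>2 / (real n)\<^sup>2"
    using assms by (simp add: radius_squared power_divide)
  also have "\<dots> \<le> real n / (real n)\<^sup>2"
    using assms by (intro divide_right_mono) auto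
  finally show ?thesis using assms(3) by (simp add: power2_eq_square)
qed

context contaminated_sample
begin

lemma prob_length_le_rate:
  assumes n: "20 ^ 4 \<le> real n" "4 * (ln (2 / \<alpha>))\<^sup>2 \<le> real n" and \<epsilon>_small: "\<epsilon> \<le> 1 / 20 ^ 4"
    and c: "12 * rate n \<epsilon> \<le> c"
  shows "1 - \<alpha> \<le> \<P>(X in sampling n \<epsilon> \<theta> Q. emeasure lborel (CI n \<alpha> X) \<le> ennreal c)"
proof -
  define s where "s = 2 * max \<delta> \<epsilon>"
  have s: "0 < s" "2 * \<delta> \<le> s" "2 * \<epsilon> \<le> s" using radius_pos by (auto simp: s_def)
  have "(2 * \<epsilon>) ^ 4 \<le> \<epsilon>"
  proof -
    have "\<epsilon> ^ 3 \<le> (1 / 20) ^ 3" using \<epsilon> by (intro power_mono) auto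
    then have "16 * \<epsilon> ^ 3 * \<epsilon> \<le> 1 * \<epsilon>"
      using \<epsilon> by (intro mult_right_mono) (auto simp: power3_eq_cube)
    then show ?thesis by (simp add: power_mult_distrib power_numeral_reduce)
  qed
  moreover have "(2 * \<delta>) ^ 4 \<le> 1 / real n"
    using n_pos \<alpha> n(2) by (intro two_mult_radius_power4_le) auto
  ultimately have s4: "s ^ 4 \<le> 1 / real n \<or> s ^ 4 \<le> \<epsilon>"
    by (auto simp: s_def max_def)
  moreover have "1 / real n \<le> 1 / 20 ^ 4" using n(1) by (intro divide_left_mono) auto
  ultimately have "s ^ 4 \<le> (1 / 20) ^ 4" using \<epsilon>_small by (auto simp: power_divide)
  then have s_le: "s \<le> 1 / 20" using s power_mono_iff[of s "1 / 20" 4] by simp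
  define t where "t = quantile \<Phi> (1 - s)"
  have Phi_t: "\<Phi> t = 1 - s" using s s_le by (simp add: t_def Phi_quantile)
  then have "\<Phi> 1.6 \<le> \<Phi> t" using s_le normal_tail_1_6_greater by simp
  then have t: "1.6 \<le> t" by simp
  have t_max: "t \<le> t_max n \<alpha>" using s radius_pos Phi_t by (simp add: le_t_max_iff)
  have "4 / t \<le> 12 * inv_sqrt_log_inv (s ^ 4)"
    using inverse_le_inv_sqrt_log_inv_normal_tail[OF t] Phi_t by simp
  also have "\<dots> \<le> 12 * rate n \<epsilon>"
    using n(1) \<epsilon> s4 by (intro mult_left_mono inv_sqrt_log_inv_le_rate) auto
  finally have "4 / t \<le> c" using c by simp
  then show ?thesis
    using Phi_t s by (intro prob_length_le[OF t t_max, of t]) auto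
qed

lemma sample_size_ge_2:
  assumes "1.6 \<le> t_max n \<alpha>"
  shows "2 \<le> n"
proof (rule ccontr)
  assume "\<not> 2 \<le> n"
  then have "n = 1" using n_pos by simp
  have "\<delta> \<le> 1 - \<Phi> 1.6" using assms by (simp only: le_t_max_iff)
  then have "\<delta> < 1 / 5" using normal_tail_less_fifth[of "1.6"] by simp
  then have "\<delta>\<^sup>2 < (1 / 5)\<^sup>2" using radius_pos by (intro power_strict_mono) auto
  moreover have "\<delta>\<^sup>2 = ln (2 / \<alpha>) / 2" using \<alpha> \<open>n = 1\<close> by (simp add: radius_squared)
  moreover have "ln 2 \<le> ln (2 / \<alpha>)" using \<alpha> by (simp add: field_simps)
  ultimately show False using ln2_ge_two_thirds by (simp add: power2_eq_square)
qed

lemma prob_length_le_mult_rate: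
  assumes T: "1.6 \<le> t_max n \<alpha>" and M: "20 ^ 4 \<le> M" "4 * (ln (2 / \<alpha>))\<^sup>2 \<le> M"
    and K: "1 - \<Phi> K \<le> 0.002" and C: "12 \<le> C" "2 * K \<le> C * inv_sqrt_log_inv (1 / M)"
  shows "1 - \<alpha> \<le> \<P>(X in sampling n \<epsilon> \<theta> Q. emeasure lborel (CI n \<alpha> X) \<le> ennreal (C * rate n \<epsilon>))"
proof (cases "M \<le> real n \<and> \<epsilon> \<le> 1 / M")
  case True
  have "1 / M \<le> 1 / 20 ^ 4" using M(1) by (intro divide_left_mono) auto
  then have "\<epsilon> \<le> 1 / 20 ^ 4" using True by linarith
  moreover have "0 \<le> rate n \<epsilon>"
    using inv_sqrt_log_inv_le_rate[OF sample_size_ge_2[OF T], of \<epsilon> 0] \<epsilon>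
    by (simp add: inv_sqrt_log_inv_def)
  with C(1) have "12 * rate n \<epsilon> \<le> C * rate n \<epsilon>" by (rule mult_right_mono)
  ultimately show ?thesis using True M by (intro prob_length_le_rate) auto
next
  case False
  have "0 < M" using M(1) by simp
  then have "1 / M \<le> 1 / real n \<or> 1 / M \<le> \<epsilon>"
    using False n_pos frac_le[of 1 1 "real n" M] by (auto simp: not_le)
  then have "inv_sqrt_log_inv (1 / M) \<le> rate n \<epsilon>"
    using \<epsilon> \<open>0 < M\<close> by (intro inv_sqrt_log_inv_le_rate sample_size_ge_2[OF T]) simp_all
  then have "C * inv_sqrt_log_inv (1 / M) \<le> C * rate n \<epsilon>"
    using C(1) by (intro mult_left_mono) simp_all
  then show ?thesis using C(2) by (intro prob_length_le_const[OF T K]) simp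
qed

end

lemma prob_length_le_const_mult_rate:
  assumes "0 < \<alpha>" "\<alpha> < 1"
  obtains C where "0 < C"
    and "\<And>n \<epsilon> \<theta> Q. contaminated_sample n \<alpha> \<epsilon> Q \<Longrightarrow> 1.6 \<le> t_max n \<alpha> \<Longrightarrow>
      1 - \<alpha> \<le> \<P>(X in sampling n \<epsilon> \<theta> Q. emeasure lborel (CI n \<alpha> X) \<le> ennreal (C * rate n \<epsilon>))"
proof -
  obtain K where K: "1 - \<Phi> K \<le> 0.002"
    using ex_normal_tail_less[of "0.002"] by (auto dest: less_imp_le)
  define M where "M = max (20 ^ 4) (4 * (ln (2 / \<alpha>))\<^sup>2)"
  have M: "20 ^ 4 \<le> M" "4 * (ln (2 / \<alpha>))\<^sup>2 \<le> M" by (simp_all add: M_def)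
  then have "1 < M" by simp
  then have rate_floor_pos: "0 < inv_sqrt_log_inv (1 / M)" by (simp add: inv_sqrt_log_inv_def)
  define C where "C = max 12 (2 * K / inv_sqrt_log_inv (1 / M))"
  have "12 \<le> C" and "2 * K / inv_sqrt_log_inv (1 / M) \<le> C" by (simp_all add: C_def)
  then have C: "12 \<le> C" "2 * K \<le> C * inv_sqrt_log_inv (1 / M)"
    using rate_floor_pos by (simp_all add: pos_divide_le_eq)
  then have "0 < C" by simp
  then show ?thesis
    using contaminated_sample.prob_length_le_mult_rate[OF _ _ M K C] by (rule that)
qed

section \<open>Admissible sample sizes\<close>

lemma radius_le_if_small_level:
  assumes "0 < \<alpha>" "\<alpha> \<le> 1 / 2" "400 * ln (1 / \<alpha>) \<le> real n" "n > 0"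
  shows "radius n \<alpha> \<le> 0.05"
proof -
  have "ln 2 \<le> ln (1 / \<alpha>)" using assms by (simp add: field_simps)
  moreover have "ln (2 / \<alpha>) = ln 2 + ln (1 / \<alpha>)" using assms by (simp add: ln_div)
  ultimately have "400 * ln (2 / \<alpha>) \<le> 2 * real n" using assms(3) by linarith
  then have "ln (2 / \<alpha>) / (2 * real n) \<le> 0.05\<^sup>2"
    using assms(4) by (simp add: field_simps power2_eq_square)
  then show ?thesis unfolding radius_def by (intro real_le_lsqrt) auto
qed

lemma radius_less_1_if_large_level:
  assumes "1 / 2 \<le> \<alpha>" "\<alpha> < 1" "n > 0"
  shows "radius n \<alpha> < 1"
proof -
  have "ln (1 / \<alpha>) \<le> ln 2" using assms by (simp add: field_simps)
  moreover have "ln (2 / \<alpha>) = ln 2 + ln (1 / \<alpha>)" using assms by (simp add: ln_div)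
  ultimately have "ln (2 / \<alpha>) < 2" using ln_2_less_1 by linarith
  then show ?thesis using assms by (simp add: radius_def field_simps)
qed

lemma contaminated_sample_if_sample_size_ge:
  assumes \<alpha>: "0 < \<alpha>" "\<alpha> < 1" and n: "400 * ln (1 / \<alpha>) \<le> real n"
    and "\<epsilon> \<in> {0..0.05}" "real_distribution Q"
  shows "contaminated_sample n \<alpha> \<epsilon> Q"
proof (rule contaminated_sample.intro)
  have "0 < ln (1 / \<alpha>)" using \<alpha> by simp
  then show "n > 0" using n by (auto intro: gr0I)
  then show "radius n \<alpha> < 1"
    using radius_le_if_small_level[OF \<alpha>(1) _ n] radius_less_1_if_large_level[of \<alpha> n] \<alpha>
    by (cases "\<alpha> \<le> 1 / 2") auto
qed (use assms in auto)

lemma t_max_ge_if_small_level: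
  assumes "0 < \<alpha>" "\<alpha> \<le> 1 / 2" "400 * ln (1 / \<alpha>) \<le> real n"
  shows "1.6 \<le> t_max n \<alpha>"
proof -
  interpret contaminated_sample n \<alpha> 0 0 std_normal_distribution
    using assms by (intro contaminated_sample_if_sample_size_ge real_dist_normal_dist) auto
  have "\<delta> \<le> 0.05" using assms n_pos by (intro radius_le_if_small_level) auto
  then show ?thesis using normal_tail_1_6_greater by (simp add: le_t_max_iff)
qed

theorem theorem2:
  shows "\<exists>C::real. C > 0 \<and> (\<forall>\<alpha>::real. 0 < \<alpha> \<and> \<alpha> < 1 \<longrightarrow>
    (\<exists>C'::real. C' > 0 \<and> (\<forall>n::nat. real n \<ge> C * ln (1 / \<alpha>) \<longrightarrow>
      (INF (\<epsilon>, \<theta>, Q) \<in> {0..0.05} \<times> UNIV \<times> {Q. real_distribution Q}.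
         \<P>(X in sampling n \<epsilon> \<theta> Q. \<theta> \<in> CI n \<alpha> X)) \<ge> 1 - \<alpha> \<and>
      (\<alpha> \<le> 1 / 2 \<or> 1.6 \<le> t_max n \<alpha> \<longrightarrow>
        (INF (\<epsilon>, \<theta>, Q) \<in> {0..0.05} \<times> UNIV \<times> {Q. real_distribution Q}.
           \<P>(X in sampling n \<epsilon> \<theta> Q.
              emeasure lborel (CI n \<alpha> X)
                \<le> ennreal (C' * (1 / sqrt (ln (real n)) + inv_sqrt_log_inv \<epsilon>)))) \<ge> 1 - \<alpha>))))"
proof (rule exI[of _ "400::real"], intro conjI allI impI, goal_cases)
  case (2 \<alpha>)
  then have \<alpha>: "0 < \<alpha>" "\<alpha> < 1" by auto
  note sample = contaminated_sample_if_sample_size_ge[OF \<alpha>]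
  let ?models = "{0..0.05} \<times> UNIV \<times> {Q. real_distribution Q}"
  have nonempty: "{0..0.05::real} \<noteq> {}" "(UNIV :: real set) \<noteq> {}" "{Q. real_distribution Q} \<noteq> {}"
    using real_dist_normal_dist by auto
  have coverage: "1 - \<alpha> \<le> (INF (\<epsilon>, \<theta>, Q) \<in> ?models. \<P>(X in sampling n \<epsilon> \<theta> Q. \<theta> \<in> CI n \<alpha> X))"
    if "400 * ln (1 / \<alpha>) \<le> real n" for n
    using that
    by (intro le_cINF_triple[OF nonempty] contaminated_sample.prob_mem_CI[OF sample]) simp_all
  obtain C' where C': "0 < C'"
    and prob_length: "\<And>n \<epsilon> \<theta> Q. contaminated_sample n \<alpha> \<epsilon> Q \<Longrightarrow> 1.6 \<le> t_max n \<alpha> \<Longrightarrow>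
      1 - \<alpha> \<le> \<P>(X in sampling n \<epsilon> \<theta> Q. emeasure lborel (CI n \<alpha> X) \<le> ennreal (C' * rate n \<epsilon>))"
    by (blast intro: prob_length_le_const_mult_rate[OF \<alpha>])
  have length: "1 - \<alpha> \<le> (INF (\<epsilon>, \<theta>, Q) \<in> ?models.
      \<P>(X in sampling n \<epsilon> \<theta> Q. emeasure lborel (CI n \<alpha> X) \<le> ennreal (C' * rate n \<epsilon>)))"
    if "400 * ln (1 / \<alpha>) \<le> real n" "1.6 \<le> t_max n \<alpha>" for n
    using that by (intro le_cINF_triple[OF nonempty] prob_length[OF sample]) simp_all
  show ?case
    using C' coverage length[unfolded rate_def] t_max_ge_if_small_level[OF \<alpha>(1)] by blast
qed simp

end
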